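(* Let $n\ge 2$ be an integer and let $\mathscr{L}_n$ be the moon (defined in the context). In the convex grabbing game on $\mathscr{L}_n$, if Bob follows the Simple greedy tactic, he obtains all red cherries, whatever Alice does. Consequently $M(\mathscr{L}_n)=R(\mathscr{L}_n)=n-1$.
   Context: Convex grabbing game: a cake is a finite set of points (cherries) in general position in the plane, each with weight in $\{0,1\}$ (weight 1: red, weight 0: green). For a set $C$ of remaining cherries, $\mathrm{Ex}(C)=\{c\in C: c\notin\mathrm{Conv}(C\setminus\{c\})\}$. Alice and Bob alternate, Alice first; each move removes one cherry of $\mathrm{Ex}(C)$ and gives it to the mover, until none remain. Bob's score is the number of red cherries he took; Alice wants to minimize it and Bob to maximize it. $M(\mathcal{C})$ is Bob's score under optimal play by both; $R(C)$ is the number of red cherries in $C$. Moon $\mathscr{L}_n$ ($n\ge2$): fix a point $S$, the circle $\alpha$ of radius $1$ centred at $S$, and the circle $\beta$ of radius $1-\varepsilon$ centred at $S$, where $0<\varepsilon<1-\cos(90^\circ/n)$. Draw $n$ lines through $S$ so that consecutive lines form angles of $180^\circ/n$. Choose one of them as the main line, and keep only one of the two closed half-planes it determines. Place a green cherry at every intersection point of any of the $n$ lines with $\alpha$ lying in the kept closed half-plane, and a red cherry at every intersection point of any non-main line with $\beta$ lying in the kept half-plane. Then $\mathscr{L}_n$ has $n-1$ red and $n+1$ green cherries, and its extremal cherries are exactly the green ones. Simple greedy tactic: if there is an extremal red cherry, take an extremal red cherry; otherwise take any extremal cherry. *)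

theory Defs
  imports "HOL-Analysis.Analysis"
begin

text \<open>The plane is the type of complex numbers, with its structure as a two-dimensional
  Euclidean space.\<close>

record cake =
  cherries :: "complex set"
  weight :: "complex \<Rightarrow> nat"

text \<open>Weight 1 means red and weight 0 means green. The weight function is total, but only its
  values on the cherries of the cake are relevant.\<close>

definition red :: "cake \<Rightarrow> complex set" where
  "red K = {c \<in> cherries K. weight K c = 1}"

definition num_red :: "cake \<Rightarrow> nat" where
  "num_red K = card (red K)"

definition extremal :: "complex set \<Rightarrow> complex set" where
  "extremal C = {c \<in> C. c \<notin> convex hull (C - {c})}"

lemma extremal_subset: "extremal C \<subseteq> C"
  by (auto simp: extremal_def)

lemma extremal_nonempty:
  assumes "finite C" "C \<noteq> {}"
  shows "extremal C \<noteq> {}"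
proof -
  have "convex hull C = convex hull {x. x extreme_point_of (convex hull C)}"
    using assms by (intro Krein_Milman_Minkowski) (auto simp: finite_imp_compact_convex_hull)
  moreover have "convex hull C \<noteq> {}"
    using assms by simp
  ultimately obtain x where x: "x extreme_point_of (convex hull C)"
    by fastforce
  then have "x \<in> C"
    by (rule extreme_point_of_convex_hull)
  moreover have "x \<notin> convex hull (C - {x})"
  proof
    assume "x \<in> convex hull (C - {x})"
    moreover have "convex hull (C - {x}) \<subseteq> convex hull C"
      by (intro hull_mono) auto
    ultimately have "x extreme_point_of (convex hull (C - {x}))"
      using x by (auto simp: extreme_point_of_def)
    then show False
      using extreme_point_of_convex_hull by blast
  qed
  ultimately show ?thesis
    by (auto simp: extremal_def)
qed

datatype player = Alice | Bob

text \<open>\<open>game_value w p C\<close> is the score Bob collects from the remaining cherries \<open>C\<close> when player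
  \<open>p\<close> is to move and both players play optimally. By \<open>extremal_nonempty\<close>, the minimum and the maximum
  are taken over finite nonempty sets. The value 0 for infinite \<open>C\<close> is a dummy.\<close>

function game_value :: "(complex \<Rightarrow> nat) \<Rightarrow> player \<Rightarrow> complex set \<Rightarrow> nat" where
  "game_value w Alice C =
     (if finite C \<and> C \<noteq> {} then Min ((\<lambda>c. game_value w Bob (C - {c})) ` extremal C) else 0)"
| "game_value w Bob C =
     (if finite C \<and> C \<noteq> {} then Max ((\<lambda>c. w c + game_value w Alice (C - {c})) ` extremal C) else 0)"
  by pat_completeness auto
termination
  by (relation "Wellfounded.measure (\<lambda>(w, p, C). card C)") (auto simp: extremal_def simp del: card_Diff_insert card_Diff_singleton intro: card_Diff1_less)

declare game_value.simps [simp del]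

definition optimal_score :: "cake \<Rightarrow> nat" where
  "optimal_score K = game_value (weight K) Alice (cherries K)"

text \<open>A play is recorded as the list of removed cherries in the order of their removal; moves are
  numbered from 0.\<close>

definition mover :: "nat \<Rightarrow> player" where
  "mover i = (if even i then Alice else Bob)"

definition remaining :: "cake \<Rightarrow> complex list \<Rightarrow> nat \<Rightarrow> complex set" where
  "remaining K cs i = cherries K - set (take i cs)"

definition complete_play :: "cake \<Rightarrow> complex list \<Rightarrow> bool" where
  "complete_play K cs \<longleftrightarrow>
     (\<forall>i < length cs. cs ! i \<in> extremal (remaining K cs i)) \<and> remaining K cs (length cs) = {}"

definition taken_by :: "player \<Rightarrow> complex list \<Rightarrow> complex set" where
  "taken_by p cs = {cs ! i |i. i < length cs \<and> mover i = p}"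

text \<open>The greedy rule leaves some choices open, so it is a constraint on plays, not a single strategy:
  the player may take any extremal red cherry if there is one, and any extremal cherry otherwise.\<close>

definition follows_simple_greedy :: "player \<Rightarrow> cake \<Rightarrow> complex list \<Rightarrow> bool" where
  "follows_simple_greedy p K cs \<longleftrightarrow>
     (\<forall>i < length cs. mover i = p \<longrightarrow>
        (if extremal (remaining K cs i) \<inter> red K \<noteq> {}
         then cs ! i \<in> extremal (remaining K cs i) \<inter> red K
         else cs ! i \<in> extremal (remaining K cs i)))"

definition line_through :: "complex \<Rightarrow> real \<Rightarrow> complex set" where
  "line_through S \<theta> = {S + of_real t * cis \<theta> |t. True}"

definition moon_lines :: "nat \<Rightarrow> complex \<Rightarrow> real \<Rightarrow> complex set set" where
  "moon_lines n S \<theta> = {line_through S (\<theta> + real k * pi / real n) |k. k < n}"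

definition closed_half_planes :: "complex set \<Rightarrow> complex set set" where
  "closed_half_planes l =
     {{x. a \<bullet> x \<le> b} |a b. a \<noteq> 0 \<and> l = {x. a \<bullet> x = b}}"

definition moon_green :: "complex \<Rightarrow> complex set set \<Rightarrow> complex set \<Rightarrow> complex set" where
  "moon_green S Ls H = {p \<in> sphere S 1. p \<in> \<Union>Ls \<and> p \<in> H}"

definition moon_red ::
    "complex \<Rightarrow> real \<Rightarrow> complex set set \<Rightarrow> complex set \<Rightarrow> complex set \<Rightarrow> complex set" where
  "moon_red S \<epsilon> Ls l\<^sub>0 H = {p \<in> sphere S (1 - \<epsilon>). p \<in> \<Union>(Ls - {l\<^sub>0}) \<and> p \<in> H}"

text \<open>The moon depends on several free choices: the centre, the rotation of the pencil of lines,
  the main line \<open>l\<^sub>0\<close>, the side \<open>H\<close> of it that is kept, and \<open>\<epsilon>\<close>. The predicate holds for the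
  outcome of any of these choices.\<close>

definition is_moon :: "nat \<Rightarrow> cake \<Rightarrow> bool" where
  "is_moon n K \<longleftrightarrow>
     (\<exists>S \<theta> \<epsilon> l\<^sub>0 H.
        0 < \<epsilon> \<and> \<epsilon> < 1 - cos (pi / (2 * real n)) \<and>
        l\<^sub>0 \<in> moon_lines n S \<theta> \<and> H \<in> closed_half_planes l\<^sub>0 \<and>
        cherries K = moon_green S (moon_lines n S \<theta>) H \<union> moon_red S \<epsilon> (moon_lines n S \<theta>) l\<^sub>0 H \<and>
        (\<forall>c \<in> moon_green S (moon_lines n S \<theta>) H. weight K c = 0) \<and>
        (\<forall>c \<in> moon_red S \<epsilon> (moon_lines n S \<theta>) l\<^sub>0 H. weight K c = 1))"

end

theory Submission
  imports Defs
begin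

text \<open>Number the directions of the moon by \<open>0, \<dots>, n\<close> along the kept half circle, and let \<open>g k\<close>
  and \<open>r k\<close> be the green and the red point in direction \<open>k\<close>. Before each move of Alice the remaining
  cherries are \<open>g a\<close>, \<open>g b\<close> and the pairs \<open>g j\<close>, \<open>r j\<close> for \<open>j\<close> in some set \<open>J\<close> with
  \<open>a < j < b\<close>. No red cherry is extremal there, because \<open>r j\<close> lies in the triangle \<open>g a\<close>, \<open>g j\<close>,
  \<open>g b\<close>. If Alice takes \<open>g j\<close>, then \<open>r j\<close> is the only extremal red cherry; if she takes \<open>g a\<close> or
  \<open>g b\<close>, it is the red cherry whose direction is nearest to the removed one. Bob takes it, and the
  position has the same shape again.\<close>

section \<open>Games on positions that favour the greedy player\<close>

text \<open>An invariant for positions with Alice to move. The existential clause guarantees Bob a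
  red reply, which gives the value of the game; the universal clause covers every red reply, which
  gives the claim about arbitrary greedy plays. Once no red cherry is left, nothing is required of
  later positions.\<close>

definition greedy_safe :: "(complex \<Rightarrow> nat) \<Rightarrow> complex set set \<Rightarrow> bool" where
  "greedy_safe w I \<longleftrightarrow>
     (\<forall>C \<in> I. finite C \<and> w ` C \<subseteq> {0, 1} \<and>
        (\<forall>c \<in> extremal C. w c = 0 \<and>
           ((\<exists>x \<in> C. w x = 1) \<longrightarrow>
              (\<exists>d \<in> extremal (C - {c}). w d = 1) \<and>
              (\<forall>d \<in> extremal (C - {c}). w d = 1 \<longrightarrow> C - {c} - {d} \<in> I))))"

lemma card_weight_remove:
  assumes "finite C" "c \<in> C" "w ` C \<subseteq> {0, 1 :: nat}"
  shows "card {x \<in> C. w x = 1} = w c + card {x \<in> C - {c}. w x = 1}"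
proof (cases "w c = 1")
  case True
  then have "{x \<in> C. w x = 1} = insert c {x \<in> C - {c}. w x = 1}"
    using assms by auto
  then show ?thesis
    using True assms by simp
next
  case False
  then have "{x \<in> C. w x = 1} = {x \<in> C - {c}. w x = 1}" "w c = 0"
    using assms by auto
  then show ?thesis
    by simp
qed

lemma game_value_le_card:
  assumes "finite C" "w ` C \<subseteq> {0, 1}"
  shows "game_value w p C \<le> card {x \<in> C. w x = 1}"
  using assms
proof (induction "card C" arbitrary: C p rule: less_induct)
  case less
  note ex = extremal_subset[of C]
  have fin: "finite (extremal C)"
    using ex less.prems(1) finite_subset by blast
  have step: "w c + game_value w q (C - {c}) \<le> card {x \<in> C. w x = 1}" if "c \<in> extremal C" for c q
  proof -
    have "c \<in> C" using that ex by auto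
    have "card (C - {c}) < card C"
      using less.prems(1) \<open>c \<in> C\<close> by (rule card_Diff1_less)
    then have "game_value w q (C - {c}) \<le> card {x \<in> C - {c}. w x = 1}"
      using less.prems by (intro less.hyps) auto
    then show ?thesis
      using card_weight_remove[OF less.prems(1) \<open>c \<in> C\<close> less.prems(2)] by linarith
  qed
  show ?case
  proof (cases "C = {}")
    case True
    then show ?thesis by (cases p) (simp_all add: game_value.simps)
  next
    case False
    then have ne: "extremal C \<noteq> {}"
      using extremal_nonempty less.prems by blast
    show ?thesis
    proof (cases p)
      case Alice
      obtain c where c: "c \<in> extremal C" using ne by blast
      have "game_value w p C \<le> game_value w Bob (C - {c})"
        using Alice False less.prems c fin by (simp add: game_value.simps(1)[of w C])
      then show ?thesis
        using step[OF c, of Bob] by linarith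
    next
      case Bob
      then show ?thesis
        using False less.prems fin ne step by (simp add: game_value.simps(2)[of w C])
    qed
  qed
qed

text \<open>The upper bound is \<open>game_value_le_card\<close>. For the lower bound, each move of
  Alice takes a green cherry and keeps the red count, and some red reply of Bob leads back into
  \<open>I\<close> with one red cherry fewer, so induction applies.\<close>

lemma game_value_greedy_safe:
  assumes safe: "greedy_safe w I" and "C \<in> I"
  shows "game_value w Alice C = card {x \<in> C. w x = 1}"
  using \<open>C \<in> I\<close>
proof (induction "card C" arbitrary: C rule: less_induct)
  case less
  have fin: "finite C" and w01: "w ` C \<subseteq> {0, 1}"
    using safe less.prems by (auto simp: greedy_safe_def)
  note up = game_value_le_card[OF fin w01, of Alice]
  show ?case
  proof (cases "\<exists>x \<in> C. w x = 1")
    case False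
    then have "card {x \<in> C. w x = 1} = 0" by (auto simp: card_eq_0_iff)
    then show ?thesis using up by linarith
  next
    case True
    then have "C \<noteq> {}" by auto
    then have ne: "extremal C \<noteq> {}"
      using extremal_nonempty fin by blast
    have "card {x \<in> C. w x = 1} \<le> game_value w Bob (C - {c})" if c: "c \<in> extremal C" for c
    proof -
      have wc: "w c = 0" using safe less.prems c unfolding greedy_safe_def by blast
      have cC: "c \<in> C" using c extremal_subset by blast
      obtain d where d: "d \<in> extremal (C - {c})" "w d = 1" and dI: "C - {c} - {d} \<in> I"
        using safe less.prems c True unfolding greedy_safe_def by meson
      have dC: "d \<in> C - {c}" using d extremal_subset by blast
      have "card (C - {c} - {d}) < card C"
        using fin cC by (intro psubset_card_mono) auto
      then have "game_value w Alice (C - {c} - {d}) = card {x \<in> C - {c} - {d}. w x = 1}"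
        using less.hyps dI by blast
      moreover have "card {x \<in> C. w x = 1} = card {x \<in> C - {c}. w x = 1}"
        using card_weight_remove[OF fin cC w01] wc by simp
      moreover have "card {x \<in> C - {c}. w x = 1} = 1 + card {x \<in> C - {c} - {d}. w x = 1}"
        using card_weight_remove[of "C - {c}" d w] fin dC image_mono[of "C - {c}" C w] w01 d(2)
        by (metis Diff_subset finite_Diff subset_trans)
      moreover have "w d + game_value w Alice (C - {c} - {d}) \<le> game_value w Bob (C - {c})"
      proof -
        have "finite (extremal (C - {c}))"
          using fin extremal_subset finite_subset by (metis finite_Diff)
        moreover have "C - {c} \<noteq> {}" using dC by blast
        ultimately show ?thesis
          using d(1) fin by (simp add: game_value.simps(2)[of w "C - {c}"] del: Diff_eq_empty_iff)
      qed
      ultimately show ?thesis using d(2) by linarith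
    qed
    then have "card {x \<in> C. w x = 1} \<le> game_value w Alice C"
      using fin ne \<open>C \<noteq> {}\<close> finite_subset[OF extremal_subset fin]
      by (simp add: game_value.simps(1)[of w C])
    then show ?thesis using up by linarith
  qed
qed

lemma remaining_Suc:
  assumes "i < length cs"
  shows "remaining K cs (Suc i) = remaining K cs i - {cs ! i}"
  using assms by (auto simp: remaining_def take_Suc_conv_app_nth)

lemma greedy_takes_red:
  assumes safe: "greedy_safe (weight K) I" and start: "cherries K \<in> I"
    and play: "complete_play K cs" and greedy: "follows_simple_greedy Bob K cs"
  shows "red K \<subseteq> taken_by Bob cs"
proof -
  \<comment> \<open>Alice moves at the even indices. The second alternative is needed because the
    position may leave \<open>I\<close> after the last red cherry is gone.\<close>
  have inv: "remaining K cs (2 * m) \<in> I \<or> remaining K cs (2 * m) \<inter> red K = {}"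
    if "2 * m \<le> length cs" for m
    using that
  proof (induction m)
    case 0
    then show ?case using start by (simp add: remaining_def)
  next
    case (Suc m)
    let ?C = "remaining K cs (2 * m)" and ?c = "cs ! (2 * m)" and ?d = "cs ! Suc (2 * m)"
    have len: "2 * m < length cs" "Suc (2 * m) < length cs"
      using Suc.prems by auto
    have r1: "remaining K cs (Suc (2 * m)) = ?C - {?c}"
      using remaining_Suc len by blast
    have r2: "remaining K cs (2 * Suc m) = ?C - {?c} - {?d}"
      using remaining_Suc[of "Suc (2 * m)"] len r1 by simp
    show ?case
    proof (cases "?C \<inter> red K = {}")
      case True
      then show ?thesis using r2 by auto
    next
      case False
      then have CI: "?C \<in> I" using Suc by auto
      have c: "?c \<in> extremal ?C"
        using play len by (auto simp: complete_play_def)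
      have "\<exists>x \<in> ?C. weight K x = 1"
        using False by (auto simp: red_def)
      then have ex: "\<exists>d \<in> extremal (?C - {?c}). weight K d = 1"
        and all: "\<forall>d \<in> extremal (?C - {?c}). weight K d = 1 \<longrightarrow> ?C - {?c} - {d} \<in> I"
        using safe CI c unfolding greedy_safe_def by meson+
      have "extremal (?C - {?c}) \<subseteq> cherries K"
        using extremal_subset by (fastforce simp: remaining_def)
      then have "extremal (?C - {?c}) \<inter> red K \<noteq> {}"
        using ex by (auto simp: red_def)
      moreover have "mover (Suc (2 * m)) = Bob"
        by (simp add: mover_def)
      moreover have "if extremal (?C - {?c}) \<inter> red K \<noteq> {} then ?d \<in> extremal (?C - {?c}) \<inter> red K
          else ?d \<in> extremal (?C - {?c})" if "mover (Suc (2 * m)) = Bob"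
        using greedy that len(2) unfolding follows_simple_greedy_def r1[symmetric] by blast
      ultimately have "?d \<in> extremal (?C - {?c}) \<inter> red K"
        by presburger
      then show ?thesis
        using all r2 by (auto simp: red_def)
    qed
  qed
  show ?thesis
  proof
    fix c assume c: "c \<in> red K"
    have "remaining K cs (length cs) = {}"
      using play by (simp add: complete_play_def)
    then have "c \<in> set cs"
      using c by (auto simp: remaining_def red_def)
    then obtain i where i: "i < length cs" "cs ! i = c"
      by (auto simp: in_set_conv_nth)
    \<comment> \<open>At an even index Alice would have taken a red cherry from a position in
      \<open>I\<close>, but there all extremal cherries have weight 0.\<close>
    have "odd i"
    proof
      assume "even i"
      then obtain m where m: "i = 2 * m" by blast
      have ext: "c \<in> extremal (remaining K cs (2 * m))"
        using play i m by (auto simp: complete_play_def)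
      then have "c \<in> remaining K cs (2 * m)"
        using extremal_subset by blast
      then have "remaining K cs (2 * m) \<in> I"
        using inv[of m] i m c by auto
      then have "weight K c = 0"
        using safe ext unfolding greedy_safe_def by blast
      then show False using c by (simp add: red_def)
    qed
    then show "c \<in> taken_by Bob cs"
      using i by (auto simp: taken_by_def mover_def)
  qed
qed

section \<open>The points of a moon\<close>

lemma inner_cis: "cis x \<bullet> cis y = cos (x - y)"
  by (simp add: inner_complex_def cos_diff)

text \<open>A certificate of extremality: a convex set that contains all other cherries contains
  their hull as well.\<close>

lemma extremal_convexI:
  assumes "r \<in> C" "C - {r} \<subseteq> X" "convex X" "r \<notin> X"
  shows "r \<in> extremal C"
  using assms hull_minimal[of "C - {r}" X convex] by (auto simp: extremal_def)

text \<open>An open half-space together with a part of its boundary, that is, a half-space for the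
  lexicographic order of \<open>f\<close> and \<open>e\<close>. It separates \<open>r j\<close> from
  the rest even when \<open>g j\<close> lies on the same ray from \<open>S\<close>.\<close>

lemma convex_lex_halfspace:
  fixes f e :: "'a::real_inner"
  shows "convex {x. b < f \<bullet> x \<or> f \<bullet> x = b \<and> c < e \<bullet> x}" (is "convex ?X")
proof (rule convexI)
  fix x y :: 'a and u v :: real
  assume x: "x \<in> ?X" and y: "y \<in> ?X" and uv: "0 \<le> u" "0 \<le> v" "u + v = 1"
  show "u *\<^sub>R x + v *\<^sub>R y \<in> ?X"
  proof (cases "u = 0 \<or> v = 0")
    case True
    then show ?thesis using x y uv by auto
  next
    case False
    then have "u > 0" "v > 0" using uv by auto
    \<comment> \<open>With both weights positive, strictness in one of the two points is
      enough.\<close>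
    have conv: "u * s + v * t > d" if "s \<ge> d" "t \<ge> d" "s > d \<or> t > d" for s t d :: real
    proof -
      have "u * s + v * t - d = u * (s - d) + v * (t - d)"
        using uv(3) by (simp add: algebra_simps flip: distrib_left)
      moreover have "u * (s - d) \<ge> 0" "v * (t - d) \<ge> 0"
        using \<open>u > 0\<close> \<open>v > 0\<close> that by auto
      moreover have "u * (s - d) > 0 \<or> v * (t - d) > 0"
        using \<open>u > 0\<close> \<open>v > 0\<close> that by auto
      ultimately show ?thesis by linarith
    qed
    have fx: "f \<bullet> x \<ge> b" and fy: "f \<bullet> y \<ge> b" using x y by auto
    show ?thesis
    proof (cases "f \<bullet> x > b \<or> f \<bullet> y > b")
      case True
      then show ?thesis using conv[OF fx fy] by (simp add: inner_add_right)
    next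
      case False
      then have eq: "f \<bullet> x = b" "f \<bullet> y = b" "e \<bullet> x > c" "e \<bullet> y > c" using x y by auto
      have "u * b + v * b = b" using uv(3) by (metis distrib_right mult_1)
      then show ?thesis using eq conv[of c "e \<bullet> x" "e \<bullet> y"] by (simp add: inner_add_right)
    qed
  qed
qed

lemma line_through_add_pi: "line_through S (\<theta> + pi) = line_through S \<theta>"
proof -
  have "S + of_real t * cis (\<theta> + pi) = S + of_real (- t) * cis \<theta>"
    "S + of_real t * cis \<theta> = S + of_real (- t) * cis (\<theta> + pi)" for t
    by (simp_all add: complex_eq_iff)
  then show ?thesis unfolding line_through_def by blast
qed

text \<open>Here \<open>\<phi>\<close> is the direction of one end of the main line. The assumptions
  mention neither \<open>S\<close> nor \<open>\<phi>\<close>, so the locale predicate takes only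
  \<open>n\<close> and \<open>\<epsilon>\<close>, and a single fact serves every rotation of the
  pencil.\<close>

locale moon_frame =
  fixes n :: nat and S :: complex and \<phi> \<epsilon> :: real
  assumes n_ge_2: "n \<ge> 2" and eps_pos: "0 < \<epsilon>" and eps_less: "\<epsilon> < 1 - cos (pi / (2 * real n))"
begin

definition angle :: "nat \<Rightarrow> real" where
  "angle k = real k * pi / real n"

definition pt :: "real \<Rightarrow> nat \<Rightarrow> complex" where
  "pt \<rho> k = S + of_real \<rho> * cis (\<phi> + angle k)"

abbreviation g :: "nat \<Rightarrow> complex" where "g \<equiv> pt 1"
abbreviation r :: "nat \<Rightarrow> complex" where "r \<equiv> pt (1 - \<epsilon>)"

lemma angle_0 [simp]: "angle 0 = 0"
  by (simp add: angle_def)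

lemma angle_n [simp]: "angle n = pi"
  using n_ge_2 by (simp add: angle_def)

lemma angle_less_iff [simp]: "angle j < angle k \<longleftrightarrow> j < k"
  using n_ge_2 by (simp add: angle_def divide_less_cancel)

lemma angle_le_iff [simp]: "angle j \<le> angle k \<longleftrightarrow> j \<le> k"
  by (simp flip: not_less)

lemma angle_nonneg: "0 \<le> angle k"
  by (simp add: angle_def)

lemma angle_diff: "j \<le> k \<Longrightarrow> angle k - angle j = angle (k - j)"
  by (simp add: angle_def of_nat_diff diff_divide_distrib left_diff_distrib)

lemma angle_le_pi: "k \<le> n \<Longrightarrow> angle k \<le> pi"
  using angle_le_iff[of k n] by simp

lemma cos_angle_le: "0 < k \<Longrightarrow> k \<le> n \<Longrightarrow> cos (angle k) \<le> cos (pi / real n)"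
  using angle_le_iff[of 1 k] angle_le_pi[of k] by (intro cos_monotone_0_pi_le) (auto simp: angle_def)

lemma sin_angle_pos: "0 < k \<Longrightarrow> k < n \<Longrightarrow> 0 < sin (angle k)"
  using angle_less_iff[of 0 k] angle_less_iff[of k n] by (intro sin_gt_zero) auto

text \<open>The bound on \<open>\<epsilon>\<close> enters the geometry in this form. The number
  cos(pi/n) is the distance from \<open>S\<close> to the chord joining the two green neighbours of a
  green point, so each red point lies beyond that chord.\<close>

lemma cos_pi_n_less: "cos (pi / real n) < 1 - \<epsilon>"
proof -
  have "pi / (2 * real n) \<le> pi / real n" "pi / real n \<le> pi"
    using n_ge_2 by (simp_all add: field_simps)
  then have "cos (pi / real n) \<le> cos (pi / (2 * real n))"
    by (intro cos_monotone_0_pi_le) auto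
  then show ?thesis using eps_less by linarith
qed

lemma radius_pos: "0 < 1 - \<epsilon>"
proof -
  have "pi / real n \<le> pi / 2"
    using n_ge_2 by (simp add: field_simps)
  then have "0 \<le> cos (pi / real n)"
    using pi_ge_zero by (intro cos_ge_zero) (auto intro: order_trans[of _ 0])
  then show ?thesis using cos_pi_n_less by linarith
qed

lemma inner_pt: "cis (\<phi> + t) \<bullet> pt \<rho> k = cis (\<phi> + t) \<bullet> S + \<rho> * cos (angle k - t)"
proof -
  have "of_real \<rho> * cis (\<phi> + angle k) = \<rho> *\<^sub>R cis (\<phi> + angle k)"
    by (simp add: scaleR_conv_of_real)
  then show ?thesis
    by (simp add: pt_def inner_add_right inner_cis cos_diff mult.commute)
qed

lemma norm_pt: "norm (pt \<rho> k - S) = \<bar>\<rho>\<bar>"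
  by (simp add: pt_def norm_mult)

text \<open>The distance to \<open>S\<close> recovers the radius. The projection to direction
  \<open>\<phi>\<close> then recovers the index, since cosine is injective on [0, pi].\<close>

lemma pt_eq_iff:
  assumes "0 < \<rho>" "0 < \<sigma>" "j \<le> n" "k \<le> n"
  shows "pt \<rho> j = pt \<sigma> k \<longleftrightarrow> \<rho> = \<sigma> \<and> j = k"
proof
  assume eq: "pt \<rho> j = pt \<sigma> k"
  then have "\<rho> = \<sigma>" using norm_pt[of \<rho> j] norm_pt[of \<sigma> k] assms by simp
  moreover have "cos (angle j) = cos (angle k)"
    using inner_pt[of 0 \<rho> j] inner_pt[of 0 \<sigma> k] eq assms \<open>\<rho> = \<sigma>\<close> by simp
  then have "angle j = angle k"
    using assms cos_inj_pi[of "angle j" "angle k"] by (simp add: angle_nonneg angle_le_pi)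
  then have "j = k" by (metis angle_less_iff linorder_neqE_nat order_less_irrefl)
  ultimately show "\<rho> = \<sigma> \<and> j = k" by simp
qed simp

lemma g_eq_iff: "j \<le> n \<Longrightarrow> k \<le> n \<Longrightarrow> g j = g k \<longleftrightarrow> j = k"
  by (simp add: pt_eq_iff)

lemma r_eq_iff: "j \<le> n \<Longrightarrow> k \<le> n \<Longrightarrow> r j = r k \<longleftrightarrow> j = k"
  using radius_pos by (simp add: pt_eq_iff)

lemma g_neq_r: "j \<le> n \<Longrightarrow> k \<le> n \<Longrightarrow> g j \<noteq> r k"
  using radius_pos eps_pos by (simp add: pt_eq_iff)

section \<open>Which red points are extremal\<close>

text \<open>The ray of \<open>r j\<close> crosses the chord from \<open>g i\<close> to
  \<open>g k\<close> at distance at most cos(pi/n) < 1 - \<open>\<epsilon>\<close> from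
  \<open>S\<close>, so \<open>r j\<close> lies between the crossing point and
  \<open>g j\<close>.\<close>

lemma red_in_triangle:
  assumes "i < j" "j < k" "k \<le> n"
  shows "r j \<in> convex hull {g i, g j, g k}"
proof -
  define a where "a = angle (j - i)"
  define b where "b = angle (k - j)"
  define s where "s = sin a + sin b"
  have sa: "sin a > 0" and sb: "sin b > 0"
    using assms by (auto simp: a_def b_def intro!: sin_angle_pos)
  then have s: "s > 0" by (simp add: s_def)
  \<comment> \<open>\<open>t\<close> is the distance from \<open>S\<close> at which the chord from \<open>g i\<close> to \<open>g k\<close> meets the ray of \<open>r j\<close>.\<close>
  define t where "t = sin (a + b) / s"
  \<comment> \<open>In the addition formula both cosines are at most cos(pi/n), because
    \<open>a\<close> and \<open>b\<close> are positive multiples of pi/n that do not exceed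
    pi.\<close>
  have "sin (a + b) \<le> cos (pi / real n) * s"
  proof -
    have "sin a * cos b \<le> sin a * cos (pi / real n)" "cos a * sin b \<le> cos (pi / real n) * sin b"
      using sa sb assms by (auto simp: a_def b_def intro!: mult_left_mono mult_right_mono cos_angle_le)
    then show ?thesis by (simp add: sin_add s_def algebra_simps)
  qed
  then have "t \<le> cos (pi / real n)" using s by (simp add: t_def field_simps)
  then have t: "t < 1 - \<epsilon>" using cos_pi_n_less by linarith
  \<comment> \<open>The weight of the crossing point when \<open>r j\<close> is written as a convex
    combination of it and \<open>g j\<close>.\<close>
  define m where "m = \<epsilon> / (1 - t)"
  have m: "0 \<le> m" "m \<le> 1" using t eps_pos by (auto simp: m_def field_simps)
  have m_eq: "1 - \<epsilon> = (1 - m) + m * t"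
  proof -
    have "m * (1 - t) = \<epsilon>" using t eps_pos by (simp add: m_def)
    then show ?thesis by (simp add: algebra_simps)
  qed
  define x where "x = cis (\<phi> + angle j)"
  have gi: "g i = S + x * cis (- a)" and gk: "g k = S + x * cis b"
    using assms by (auto simp: pt_def x_def a_def b_def cis_mult algebra_simps simp flip: angle_diff)
  have gj: "g j = S + x" and rj: "r j = S + of_real (1 - \<epsilon>) * x"
    by (simp_all add: pt_def x_def)
  \<comment> \<open>These weights make the imaginary parts cancel, so the combination lies on the
    ray of direction \<open>j\<close>.\<close>
  have chord: "of_real (sin b / s) * cis (- a) + of_real (sin a / s) * cis b = of_real t"
    by (rule complex_eqI) (simp_all add: t_def sin_add add_divide_distrib algebra_simps)
  have one: "sin b / s + sin a / s = 1"
    using s by (simp add: s_def add.commute flip: add_divide_distrib)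
  have "r j = (m * (sin b / s)) *\<^sub>R g i + (1 - m) *\<^sub>R g j + (m * (sin a / s)) *\<^sub>R g k"
  proof -
    have "(m * (sin b / s)) *\<^sub>R g i + (1 - m) *\<^sub>R g j + (m * (sin a / s)) *\<^sub>R g k
        = of_real (m * (sin b / s + sin a / s) + (1 - m)) * S
          + x * (of_real m * (of_real (sin b / s) * cis (- a) + of_real (sin a / s) * cis b)
                 + of_real (1 - m))"
      by (simp add: gi gj gk scaleR_conv_of_real algebra_simps add_divide_distrib)
    also have "\<dots> = S + x * of_real (m * t + (1 - m))"
      unfolding one chord by simp
    also have "\<dots> = S + of_real (1 - \<epsilon>) * x"
      by (simp only: m_eq) (simp add: algebra_simps)
    also have "\<dots> = r j"
      by (simp only: rj)
    finally show ?thesis by simp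
  qed
  moreover have "m * (sin b / s) + (1 - m) + m * (sin a / s) = 1"
  proof -
    have "m * (sin b / s) + (1 - m) + m * (sin a / s) = m * (sin b / s + sin a / s) + (1 - m)"
      by (simp add: distrib_left)
    then show ?thesis unfolding one by simp
  qed
  moreover have "m * (sin b / s) \<ge> 0" "m * (sin a / s) \<ge> 0"
    using m s sa sb by auto
  ultimately show ?thesis
    unfolding convex_hull_3 using m(2)
    by (intro CollectI exI[of _ "m * (sin b / s)"] exI[of _ "1 - m"] exI[of _ "m * (sin a / s)"]) auto
qed

lemma red_not_extremal:
  assumes "i < j" "j < k" "k \<le> n" "{g i, g j, g k} \<subseteq> C"
  shows "r j \<notin> extremal C"
proof -
  have "{g i, g j, g k} \<subseteq> C - {r j}"
    using assms g_neq_r by auto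
  then show ?thesis
    using red_in_triangle[OF assms(1-3)] hull_mono[of "{g i, g j, g k}" "C - {r j}" convex]
    by (auto simp: extremal_def)
qed

lemma remaining_pointE:
  assumes "x \<in> C - {r j}" "C \<subseteq> g ` A \<union> r ` B"
  obtains \<rho> k where "x = pt \<rho> k" "\<rho> = 1 \<and> k \<in> A \<or> \<rho> = 1 - \<epsilon> \<and> k \<in> B \<and> k \<noteq> j"
  using assms by blast

text \<open>Project to direction \<open>j\<close>: \<open>r j\<close> has coordinate 1 -
  \<open>\<epsilon>\<close> relative to \<open>S\<close>, while every other point has a different
  direction and a smaller coordinate by \<open>cos_pi_n_less\<close>.\<close>

lemma red_extremal_if_green_gone:
  assumes "r j \<in> C" "C \<subseteq> g ` A \<union> r ` B" "A \<union> B \<subseteq> {..n}" "j \<le> n" "j \<notin> A"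
  shows "r j \<in> extremal C"
proof (rule extremal_convexI)
  let ?e = "cis (\<phi> + angle j)"
  let ?X = "{x. ?e \<bullet> x < ?e \<bullet> r j}"
  show "C - {r j} \<subseteq> ?X"
  proof
    fix x assume x: "x \<in> C - {r j}"
    obtain \<rho> k where xk: "x = pt \<rho> k" and "\<rho> = 1 \<and> k \<in> A \<or> \<rho> = 1 - \<epsilon> \<and> k \<in> B \<and> k \<noteq> j"
      using remaining_pointE[OF x assms(2)] by blast
    then have k: "k \<le> n" "k \<noteq> j" and \<rho>: "0 < \<rho>" "\<rho> \<le> 1"
      using assms(3,5) radius_pos eps_pos by auto
    have "cos (angle k - angle j) \<le> cos (pi / real n)"
    proof (cases "j \<le> k")
      case True
      then show ?thesis using k cos_angle_le[of "k - j"] by (simp add: angle_diff)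
    next
      case False
      then have "angle k - angle j = - angle (j - k)" using angle_diff[of k j] by simp
      then show ?thesis using False assms(4) cos_angle_le[of "j - k"] by simp
    qed
    then have c: "cos (angle k - angle j) < 1 - \<epsilon>" using cos_pi_n_less by linarith
    have "\<rho> * cos (angle k - angle j) < 1 - \<epsilon>"
    \<comment> \<open>Replacing the factor \<open>\<rho>\<close> by its bound 1 is sound only for a
      nonnegative cosine; otherwise the product is nonpositive.\<close>
    proof (cases "cos (angle k - angle j) \<le> 0")
      case True
      then show ?thesis using \<rho> radius_pos mult_nonneg_nonpos[of \<rho> "cos (angle k - angle j)"] by linarith
    next
      case False
      then show ?thesis using \<rho> c mult_right_mono[of \<rho> 1 "cos (angle k - angle j)"] by linarith
    qed
    then show "x \<in> ?X" by (simp add: xk inner_pt)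
  qed
qed (use assms convex_halfspace_lt in auto)

text \<open>All points of directions after \<open>j\<close> lie strictly on one side of the line
  through \<open>S\<close> and \<open>r j\<close>; here \<open>0 < j\<close> keeps the angle
  differences below pi. On the line itself only \<open>g j\<close> can remain, and it lies farther
  out than \<open>r j\<close>.\<close>

lemma red_extremal_if_all_above:
  assumes "r j \<in> C" "C \<subseteq> g ` A \<union> r ` B" "A \<union> B \<subseteq> {j..n}" "0 < j"
  shows "r j \<in> extremal C"
proof (rule extremal_convexI)
  let ?e = "cis (\<phi> + angle j)" and ?f = "cis (\<phi> + (angle j + pi / 2))"
  let ?X = "{x. ?f \<bullet> S < ?f \<bullet> x \<or> ?f \<bullet> x = ?f \<bullet> S \<and> ?e \<bullet> r j < ?e \<bullet> x}"
  have f: "?f \<bullet> pt \<rho> k = ?f \<bullet> S + \<rho> * sin (angle k - angle j)" for \<rho> k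
    using inner_pt[of "angle j + pi / 2" \<rho> k] cos_diff[of "angle k - angle j" "pi / 2"]
    by (simp add: algebra_simps)
  show "C - {r j} \<subseteq> ?X"
  proof
    fix x assume x: "x \<in> C - {r j}"
    obtain \<rho> k where xk: "x = pt \<rho> k" and "\<rho> = 1 \<and> k \<in> A \<or> \<rho> = 1 - \<epsilon> \<and> k \<in> B \<and> k \<noteq> j"
      using remaining_pointE[OF x assms(2)] by blast
    then have k: "j \<le> k" "k \<le> n" and \<rho>: "\<rho> = 1 \<or> \<rho> = 1 - \<epsilon> \<and> k \<noteq> j"
      using assms(3) by auto
    show "x \<in> ?X"
    proof (cases "k = j")
      case True
      then show ?thesis using \<rho> eps_pos xk by (simp add: f inner_pt)
    next
      case False
      then have "sin (angle k - angle j) > 0"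
        using k assms(4) sin_angle_pos[of "k - j"] by (simp add: angle_diff)
      then show ?thesis using \<rho> radius_pos xk by (auto simp: f)
    qed
  qed
  show "r j \<notin> ?X" by (simp add: f)
qed (use assms convex_lex_halfspace in auto)

text \<open>The mirror image of the previous lemma, with the normal turned the other way and
  \<open>j < n\<close> keeping the angle differences below pi.\<close>

lemma red_extremal_if_all_below:
  assumes "r j \<in> C" "C \<subseteq> g ` A \<union> r ` B" "A \<union> B \<subseteq> {..j}" "j < n"
  shows "r j \<in> extremal C"
proof (rule extremal_convexI)
  let ?e = "cis (\<phi> + angle j)" and ?f = "cis (\<phi> + (angle j - pi / 2))"
  let ?X = "{x. ?f \<bullet> S < ?f \<bullet> x \<or> ?f \<bullet> x = ?f \<bullet> S \<and> ?e \<bullet> r j < ?e \<bullet> x}"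
  have f: "?f \<bullet> pt \<rho> k = ?f \<bullet> S + \<rho> * sin (angle j - angle k)" for \<rho> k
    using inner_pt[of "angle j - pi / 2" \<rho> k] cos_add[of "angle k - angle j" "pi / 2"]
      sin_minus[of "angle k - angle j"]
    by (simp add: algebra_simps)
  show "C - {r j} \<subseteq> ?X"
  proof
    fix x assume x: "x \<in> C - {r j}"
    obtain \<rho> k where xk: "x = pt \<rho> k" and "\<rho> = 1 \<and> k \<in> A \<or> \<rho> = 1 - \<epsilon> \<and> k \<in> B \<and> k \<noteq> j"
      using remaining_pointE[OF x assms(2)] by blast
    then have k: "k \<le> j" and \<rho>: "\<rho> = 1 \<or> \<rho> = 1 - \<epsilon> \<and> k \<noteq> j"
      using assms(3) by auto
    show "x \<in> ?X"
    proof (cases "k = j")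
      case True
      then show ?thesis using \<rho> eps_pos xk by (simp add: f inner_pt)
    next
      case False
      then have "sin (angle j - angle k) > 0"
        using k assms(4) sin_angle_pos[of "j - k"] by (simp add: angle_diff)
      then show ?thesis using \<rho> radius_pos xk by (auto simp: f)
    qed
  qed
  show "r j \<notin> ?X" by (simp add: f)
qed (use assms convex_lex_halfspace in auto)

section \<open>Positions before a move of Alice\<close>

definition position :: "nat \<Rightarrow> nat \<Rightarrow> nat set \<Rightarrow> complex set" where
  "position a b J = g ` insert a (insert b J) \<union> r ` J"

text \<open>Each choice of \<open>k\<close> leaves exactly one extremal red cherry. It comes from
  direction \<open>k\<close> if \<open>k\<close> is in \<open>J\<close>, and otherwise from the
  direction of \<open>J\<close> nearest to the removed end. Here \<open>j0\<close> witnesses that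
  \<open>J\<close> is nonempty.\<close>

lemma position_remove:
  assumes pos: "a < b" "b \<le> n" "J \<subseteq> {a<..<b}" "j0 \<in> J" and k: "k \<in> insert a (insert b J)"
  shows "extremal (position a b J - {g k}) \<inter> r ` J \<noteq> {} \<and>
    (\<forall>d \<in> extremal (position a b J - {g k}) \<inter> r ` J.
       \<exists>a' b' J'. position a b J - {g k} - {d} = position a' b' J' \<and>
          a' < b' \<and> b' \<le> n \<and> J' \<subseteq> {a'<..<b'})"
proof -
  let ?C = "position a b J - {g k}"
  have finJ: "finite J" and Jne: "J \<noteq> {}" using pos finite_subset by auto
  have bounds: "\<And>j. j \<in> J \<Longrightarrow> a < j \<and> j < b \<and> j \<le> n" using pos by fastforce
  have kn: "k \<le> n" using k pos bounds by auto
  have C: "?C = g ` (insert a (insert b J) - {k}) \<union> r ` J"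
    using kn pos bounds by (auto simp: position_def g_eq_iff g_neq_r)
  have red_mem: "r j \<in> ?C" if "j \<in> J" for j
    using that by (simp add: C)
  have rem: "?C - {r j} = g ` (insert a (insert b J) - {k}) \<union> r ` (J - {j})" if "j \<in> J" for j
    unfolding C using pos bounds that by (auto simp: r_eq_iff g_neq_r[symmetric])
  \<comment> \<open>A red cherry whose own green partner survives stays covered as long as a green
    cherry remains on each side.\<close>
  have blocked: "r j \<notin> extremal ?C"
    if "j \<in> J" "j \<noteq> k" "p < j" "j < q" "p \<in> insert a (insert b J)" "q \<in> insert a (insert b J)"
      "p \<noteq> k" "q \<noteq> k" for j p q
    using that bounds pos by (intro red_not_extremal[of p j q]) (auto simp: C)
  \<comment> \<open>The common end of the three cases: \<open>r j\<close> is the only extremal red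
    cherry, and its removal gives a position with ends \<open>a'\<close> and
    \<open>b'\<close>.\<close>
  have conclude: ?thesis
    if "j \<in> J" "r j \<in> extremal ?C" "\<And>i. i \<in> J \<Longrightarrow> i \<noteq> j \<Longrightarrow> r i \<notin> extremal ?C"
      "insert a (insert b J) - {k} = insert a' (insert b' (J - {j}))"
      "a' < b'" "b' \<le> n" "J - {j} \<subseteq> {a'<..<b'}" for j a' b'
  proof -
    have "?C - {r j} = position a' b' (J - {j})"
      by (rule trans[OF rem[OF that(1), unfolded that(4)] position_def[symmetric]])
    moreover have "extremal ?C \<inter> r ` J = {r j}"
      using that(1-3) by blast
    ultimately show ?thesis using that(5-7) by auto
  qed
  consider "k \<in> J" | "k = a" "k \<notin> J" | "k = b" "k \<notin> J" using k by auto
  then show ?thesis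
  proof cases
    case 1
    show ?thesis
    proof (rule conclude[of k a b])
      show "r k \<in> extremal ?C"
        using bounds pos kn
        by (intro red_extremal_if_green_gone[OF red_mem[OF 1] equalityD1[OF C]]) auto
      show "r i \<notin> extremal ?C" if "i \<in> J" "i \<noteq> k" for i
        using that 1 bounds by (intro blocked[of i a b]) auto
    qed (use 1 pos bounds in auto)
  next
    case 2
    define m where "m = Min J"
    have m: "m \<in> J" "\<And>i. i \<in> J \<Longrightarrow> m \<le> i" using finJ Jne by (auto simp: m_def)
    show ?thesis
    \<comment> \<open>Having lost its red partner, \<open>g m\<close> becomes the new left end, and
      it covers the later red cherries from that side.\<close>
    proof (rule conclude[of m m b])
      show "r m \<in> extremal ?C"
      proof (rule red_extremal_if_all_above[OF red_mem[OF m(1)] equalityD1[OF C]])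
        show "insert a (insert b J) - {k} \<union> J \<subseteq> {m..n}"
          using m 2 bounds pos by (auto simp: less_imp_le)
        show "0 < m" using m bounds by fastforce
      qed
      show "r i \<notin> extremal ?C" if "i \<in> J" "i \<noteq> m" for i
        using that 2 bounds m pos by (intro blocked[of i m b]) (auto simp: le_neq_trans)
      show "insert a (insert b J) - {k} = insert m (insert b (J - {m}))"
        using 2 m pos by auto
      show "J - {m} \<subseteq> {m<..<b}" using m bounds by (force simp: order_le_less)
    qed (use 2 m pos bounds in auto)
  next
    case 3
    define m where "m = Max J"
    have m: "m \<in> J" "\<And>i. i \<in> J \<Longrightarrow> i \<le> m" using finJ Jne by (auto simp: m_def)
    show ?thesis
    proof (rule conclude[of m a m])
      show "r m \<in> extremal ?C"
      proof (rule red_extremal_if_all_below[OF red_mem[OF m(1)] equalityD1[OF C]])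
        show "insert a (insert b J) - {k} \<union> J \<subseteq> {..m}"
          using m 3 bounds pos by (auto simp: less_imp_le)
        show "m < n" using m bounds pos by fastforce
      qed
      show "r i \<notin> extremal ?C" if "i \<in> J" "i \<noteq> m" for i
        using that 3 bounds m pos by (intro blocked[of i a m]) (auto simp: le_neq_trans)
      show "insert a (insert b J) - {k} = insert a (insert m (J - {m}))"
        using 3 m pos by auto
      show "J - {m} \<subseteq> {a<..<m}" using m bounds by (force simp: order_le_less)
    qed (use 3 m pos bounds in auto)
  qed
qed

lemma greedy_safe_positions:
  assumes wg: "\<And>k. k \<le> n \<Longrightarrow> w (g k) = 0" and wr: "\<And>k. 0 < k \<Longrightarrow> k < n \<Longrightarrow> w (r k) = 1"
  shows "greedy_safe w {position a b J |a b J. a < b \<and> b \<le> n \<and> J \<subseteq> {a<..<b}}"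
    (is "greedy_safe w ?I")
  unfolding greedy_safe_def
proof (intro ballI)
  fix C assume "C \<in> ?I"
  then obtain a b J where C: "C = position a b J" and pos: "a < b" "b \<le> n" "J \<subseteq> {a<..<b}"
    by blast
  have bounds: "\<And>j. j \<in> J \<Longrightarrow> a < j \<and> j < b \<and> 0 < j \<and> j < n" using pos by fastforce
  have wg0: "w (g k) = 0" if "k \<in> insert a (insert b J)" for k
    using that pos bounds by (intro wg) (auto simp: less_imp_le)
  have wr1: "w (r k) = 1" if "k \<in> J" for k
    using that bounds by (intro wr) auto
  have "finite C" using pos finite_subset by (auto simp: C position_def)
  moreover have "w ` C \<subseteq> {0, 1}"
    using wg0 wr1 by (auto simp: C position_def)
  moreover have "w c = 0 \<and> ((\<exists>x \<in> C. w x = 1) \<longrightarrow>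
              (\<exists>d \<in> extremal (C - {c}). w d = 1) \<and>
              (\<forall>d \<in> extremal (C - {c}). w d = 1 \<longrightarrow> C - {c} - {d} \<in> ?I))"
    if c: "c \<in> extremal C" for c
  proof -
    \<comment> \<open>With both ends and its own green partner present, no red cherry is extremal,
      so Alice must take a green one.\<close>
    have "r j \<notin> extremal C" if "j \<in> J" for j
      using that bounds pos by (intro red_not_extremal[of a j b]) (auto simp: C position_def)
    then obtain k where k: "k \<in> insert a (insert b J)" "c = g k"
      using c extremal_subset[of C] by (force simp: C position_def)
    have red: "d \<in> r ` J \<longleftrightarrow> w d = 1" if "d \<in> C" for d
      using that wg0 wr1 by (auto simp: C position_def)
    have ext: "extremal (C - {c}) \<subseteq> C"
      using extremal_subset by fastforce
    show ?thesis
    proof (intro conjI impI)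
      show "w c = 0" using wg0 k by simp
    next
      assume "\<exists>x \<in> C. w x = 1"
      then obtain j0 where "j0 \<in> J" using red by auto
      note * = position_remove[OF pos this k(1), folded C k(2)]
      have "extremal (C - {c}) \<inter> r ` J \<noteq> {}" using * by blast
      then show "\<exists>d \<in> extremal (C - {c}). w d = 1" using wr1 by auto
      show "\<forall>d \<in> extremal (C - {c}). w d = 1 \<longrightarrow> C - {c} - {d} \<in> ?I"
      proof (intro ballI impI)
        fix d assume "d \<in> extremal (C - {c})" "w d = 1"
        then have "d \<in> extremal (C - {c}) \<inter> r ` J" using red ext by auto
        then show "C - {c} - {d} \<in> ?I" using * by blast
      qed
    qed
  qed
  ultimately show "finite C \<and> w ` C \<subseteq> {0, 1} \<and>
        (\<forall>c \<in> extremal C. w c = 0 \<and>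
           ((\<exists>x \<in> C. w x = 1) \<longrightarrow>
              (\<exists>d \<in> extremal (C - {c}). w d = 1) \<and>
              (\<forall>d \<in> extremal (C - {c}). w d = 1 \<longrightarrow> C - {c} - {d} \<in> ?I)))"
    by blast
qed

section \<open>The cherries of a moon in coordinates\<close>

text \<open>The side of the main line containing the directions from \<open>\<phi>\<close> to
  \<open>\<phi>\<close> + pi, written with the inward normal; \<open>closed_half_planes\<close> uses
  the outward one.\<close>

definition half :: "complex set" where
  "half = {x. cis (\<phi> + pi / 2) \<bullet> S \<le> cis (\<phi> + pi / 2) \<bullet> x}"

lemma pt_in_half: "0 \<le> \<rho> \<Longrightarrow> k \<le> n \<Longrightarrow> pt \<rho> k \<in> half"
  using angle_nonneg[of k] angle_le_pi[of k]
  by (auto simp: half_def inner_pt cos_diff intro!: mult_nonneg_nonneg sin_ge_zero)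

lemma pt_on_line: "pt \<rho> k \<in> line_through S (\<phi> + angle k)"
  by (auto simp: line_through_def pt_def)

text \<open>A line through \<open>S\<close> meets the circle in two antipodal points. The second one
  lies outside \<open>half\<close> except on the main line, where it is the point of index
  \<open>n\<close>.\<close>

lemma line_circle_points:
  assumes x: "x \<in> line_through S (\<phi> + angle j)" "x \<in> sphere S \<rho>" "x \<in> half"
    and j: "j < n" and "0 < \<rho>"
  shows "x = pt \<rho> j \<or> j = 0 \<and> x = pt \<rho> n"
proof -
  obtain t where t: "x = pt t j"
    using x(1) by (auto simp: line_through_def pt_def)
  have "\<bar>t\<bar> = \<rho>"
    using x(2) norm_pt[of t j] by (simp add: t dist_norm norm_minus_commute)
  then consider "t = \<rho>" | "t = - \<rho>" by linarith
  then show ?thesis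
  proof cases
    case 2
    have "0 \<le> t * sin (angle j)"
      using x(3) by (simp add: t half_def inner_pt cos_diff)
    moreover have "t * sin (angle j) < 0" if "0 < j"
      using sin_angle_pos[of j] that j 2 assms(5) by (simp add: mult_neg_pos)
    ultimately have "j = 0" by force
    moreover have "pt t 0 = pt \<rho> n"
      using 2 by (simp add: pt_def cis.ctr complex_eq_iff)
    ultimately show ?thesis using t by simp
  qed (use t in simp)
qed

lemma pt_notin_main_line:
  assumes "0 < j" "j < n" "0 < \<rho>"
  shows "pt \<rho> j \<notin> line_through S \<phi>"
proof
  assume "pt \<rho> j \<in> line_through S \<phi>"
  then obtain t where t: "pt \<rho> j = pt t 0"
    by (auto simp: line_through_def pt_def)
  have "\<rho> * sin (angle j) = 0"
    using inner_pt[of "pi / 2" \<rho> j] inner_pt[of "pi / 2" t 0] t by (simp add: cos_diff)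
  then show False using sin_angle_pos[of j] assms by simp
qed

lemma moon_lines_angle: "moon_lines n S \<phi> = (\<lambda>k. line_through S (\<phi> + angle k)) ` {..<n}"
  by (auto simp: moon_lines_def angle_def)

lemma moon_green_eq: "moon_green S (moon_lines n S \<phi>) half = g ` {..n}"
proof (intro equalityI subsetI)
  fix x assume "x \<in> moon_green S (moon_lines n S \<phi>) half"
  then obtain j where "j < n" "x \<in> line_through S (\<phi> + angle j)" "x \<in> sphere S 1" "x \<in> half"
    by (auto simp: moon_green_def moon_lines_angle)
  then show "x \<in> g ` {..n}" using line_circle_points[of x j 1] by auto
next
  fix x assume "x \<in> g ` {..n}"
  then obtain k where k: "x = g k" "k \<le> n" by auto
  have "x \<in> \<Union>(moon_lines n S \<phi>)"
  proof (cases "k = n")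
    case True
    then have "x \<in> line_through S (\<phi> + angle 0)"
      using k pt_on_line[of 1 n] by (simp add: line_through_add_pi)
    then show ?thesis
      using n_ge_2 unfolding moon_lines_angle by (intro UnionI[OF imageI[of 0]]) auto
  next
    case False
    then show ?thesis using k pt_on_line[of 1 k] unfolding moon_lines_angle by auto
  qed
  moreover have "x \<in> sphere S 1" using norm_pt[of 1 k] k by (simp add: dist_norm norm_minus_commute)
  ultimately show "x \<in> moon_green S (moon_lines n S \<phi>) half"
    using k pt_in_half[of 1 k] by (simp add: moon_green_def)
qed

lemma moon_red_eq: "moon_red S \<epsilon> (moon_lines n S \<phi>) (line_through S \<phi>) half = r ` {0<..<n}"
proof (intro equalityI subsetI)
  fix x assume "x \<in> moon_red S \<epsilon> (moon_lines n S \<phi>) (line_through S \<phi>) half"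
  then obtain j where j: "j < n" "x \<in> line_through S (\<phi> + angle j)" "x \<in> sphere S (1 - \<epsilon>)" "x \<in> half"
    "line_through S (\<phi> + angle j) \<noteq> line_through S \<phi>"
    by (auto simp: moon_red_def moon_lines_angle)
  then have "0 < j" by (intro gr0I) auto
  then show "x \<in> r ` {0<..<n}" using line_circle_points[OF j(2-4,1)] radius_pos j by auto
next
  fix x assume "x \<in> r ` {0<..<n}"
  then obtain k where k: "x = r k" "0 < k" "k < n" by auto
  have "x \<in> line_through S (\<phi> + angle k)" using k pt_on_line by simp
  \<comment> \<open>The main line is discarded as a set, so the line of index \<open>k\<close> must
    be shown to differ from it; the point \<open>r k\<close> witnesses this.\<close>
  moreover have "line_through S (\<phi> + angle k) \<noteq> line_through S \<phi>"
    using pt_notin_main_line[of k "1 - \<epsilon>"] k radius_pos calculation by auto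
  ultimately have "x \<in> \<Union>(moon_lines n S \<phi> - {line_through S \<phi>})"
    using k unfolding moon_lines_angle by blast
  moreover have "x \<in> sphere S (1 - \<epsilon>)"
    using norm_pt[of "1 - \<epsilon>" k] k radius_pos by (simp add: dist_norm norm_minus_commute)
  ultimately show "x \<in> moon_red S \<epsilon> (moon_lines n S \<phi>) (line_through S \<phi>) half"
    using k pt_in_half[of "1 - \<epsilon>" k] radius_pos by (simp add: moon_red_def)
qed

end

section \<open>Normalising the pencil of lines\<close>

text \<open>Rotation by one step permutes the lines cyclically, because a half turn maps a line
  through \<open>S\<close> to itself.\<close>

lemma moon_lines_step:
  assumes "n > 0"
  shows "moon_lines n S (\<theta> + pi / real n) = moon_lines n S \<theta>"
proof -
  let ?l = "\<lambda>k. line_through S (\<theta> + real k * pi / real n)"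
  have "?l n = ?l 0"
    using assms by (simp add: line_through_add_pi)
  have "moon_lines n S (\<theta> + pi / real n) = (\<lambda>k. ?l (Suc k)) ` {..<n}"
  proof -
    have shift: "\<theta> + pi / real n + real k * pi / real n = \<theta> + real (Suc k) * pi / real n" for k
      by (simp add: add_divide_distrib distrib_right)
    show ?thesis unfolding moon_lines_def shift by blast
  qed
  also have "\<dots> = ?l ` Suc ` {..<n}" by (simp add: image_image)
  also have "Suc ` {..<n} = {1..<n} \<union> {n}"
    using assms by (auto simp: image_Suc_lessThan)
  also have "?l ` ({1..<n} \<union> {n}) = ?l ` ({1..<n} \<union> {0})"
    unfolding image_Un using \<open>?l n = ?l 0\<close> by simp
  also have "{1..<n} \<union> {0} = {..<n}" using assms by auto
  also have "?l ` {..<n} = moon_lines n S \<theta>" by (auto simp: moon_lines_def)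
  finally show ?thesis .
qed

lemma moon_lines_shift:
  assumes "n > 0"
  shows "moon_lines n S (\<theta> + real m * pi / real n) = moon_lines n S \<theta>"
proof (induction m)
  case (Suc m)
  have "\<theta> + real (Suc m) * pi / real n = (\<theta> + real m * pi / real n) + pi / real n"
    by (simp add: field_simps add_divide_distrib)
  then show ?case using moon_lines_step[OF assms] Suc by metis
qed simp

text \<open>The choice of the main line and of the kept side is absorbed into the rotation
  \<open>\<phi>\<close>, so that the main line has index 0 and the kept half-plane is
  \<open>half\<close>.\<close>

lemma is_moon_normal_form:
  assumes "n \<ge> 2" "is_moon n K"
  obtains S \<phi> \<epsilon> where "moon_frame n \<epsilon>"
    "cherries K = moon_frame.pt n S \<phi> 1 ` {..n} \<union> moon_frame.pt n S \<phi> (1 - \<epsilon>) ` {0<..<n}"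
    "\<forall>k \<le> n. weight K (moon_frame.pt n S \<phi> 1 k) = 0"
    "\<forall>k \<in> {0<..<n}. weight K (moon_frame.pt n S \<phi> (1 - \<epsilon>) k) = 1"
proof -
  obtain S \<theta> \<epsilon> l0 H where eps: "0 < \<epsilon>" "\<epsilon> < 1 - cos (pi / (2 * real n))"
    and l0: "l0 \<in> moon_lines n S \<theta>" and H: "H \<in> closed_half_planes l0"
    and ch: "cherries K = moon_green S (moon_lines n S \<theta>) H \<union> moon_red S \<epsilon> (moon_lines n S \<theta>) l0 H"
    and w: "\<forall>c \<in> moon_green S (moon_lines n S \<theta>) H. weight K c = 0"
      "\<forall>c \<in> moon_red S \<epsilon> (moon_lines n S \<theta>) l0 H. weight K c = 1"
    using assms(2) unfolding is_moon_def by blast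
  interpret F: moon_frame n S \<phi> \<epsilon> for \<phi>
    using assms eps by unfold_locales
  obtain m where l0m: "l0 = line_through S (\<theta> + real m * pi / real n)"
    using l0 by (auto simp: moon_lines_def)
  define \<psi> where "\<psi> = \<theta> + real m * pi / real n"
  obtain a b where a0: "a \<noteq> 0" and l0ab: "l0 = {x. a \<bullet> x = b}" and Hab: "H = {x. a \<bullet> x \<le> b}"
    using H by (auto simp: closed_half_planes_def)
  have "S + of_real t * cis \<psi> \<in> l0" for t
    by (auto simp: l0m line_through_def \<psi>_def)
  from this[of 0] this[of 1] have bS: "a \<bullet> S = b" and ae: "a \<bullet> cis \<psi> = 0"
    by (auto simp: l0ab inner_add_right)
  define s where "s = a \<bullet> cis (\<psi> + pi / 2)"
  \<comment> \<open>The normal \<open>a\<close> is orthogonal to the direction of the main line, so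
    in the plane it is a multiple of the unit normal.\<close>
  have "a = s *\<^sub>R cis (\<psi> + pi / 2)"
  proof -
    let ?c = "cos \<psi>" and ?s = "sin \<psi>"
    have e: "Re a * ?c + Im a * ?s = 0" using ae by (simp add: inner_complex_def)
    have sc: "s = Im a * ?c - Re a * ?s"
      by (simp add: s_def inner_complex_def cos_add sin_add)
    have sq: "?s * ?s + ?c * ?c = 1" by (metis sin_cos_squared_add power2_eq_square)
    have "Re a = - (s * ?s)" "Im a = s * ?c"
      using e sq unfolding sc by algebra+
    then show ?thesis by (simp add: complex_eq_iff cos_add sin_add)
  qed
  then have a_inner: "a \<bullet> x = s * (cis (\<psi> + pi / 2) \<bullet> x)" for x
    by (metis inner_scaleR_left)
  have s0: "s \<noteq> 0"
    using \<open>a = s *\<^sub>R cis (\<psi> + pi / 2)\<close> a0 by auto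
  \<comment> \<open>The sign of \<open>s\<close> tells which side is kept. For positive
    \<open>s\<close> a half turn reverses the normal; it amounts to \<open>n\<close> further steps
    and so preserves the pencil.\<close>
  obtain \<phi> where \<phi>: "moon_lines n S \<phi> = moon_lines n S \<theta>" "line_through S \<phi> = l0" "F.half \<phi> = H"
  proof (cases "s < 0")
    case True
    have "F.half \<psi> = H"
      using True unfolding F.half_def Hab bS[symmetric] a_inner by auto
    moreover have "moon_lines n S \<psi> = moon_lines n S \<theta>"
      using moon_lines_shift assms unfolding \<psi>_def by simp
    ultimately show ?thesis using that[of \<psi>] l0m by (simp add: \<psi>_def)
  next
    case False
    then have "s > 0" using s0 by simp
    have "cis (\<psi> + pi + pi / 2) = - cis (\<psi> + pi / 2)"
      by (simp only: minus_cis add_ac)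
    then have "F.half (\<psi> + pi) = H"
      using \<open>s > 0\<close> unfolding F.half_def Hab bS[symmetric] a_inner by auto
    moreover have "\<psi> + pi = \<theta> + real (m + n) * pi / real n"
      using assms by (simp add: \<psi>_def field_simps)
    then have "moon_lines n S (\<psi> + pi) = moon_lines n S \<theta>"
      using moon_lines_shift[of n S \<theta> "m + n"] assms by simp
    ultimately show ?thesis using that[of "\<psi> + pi"] l0m line_through_add_pi by (simp add: \<psi>_def)
  qed
  have G: "moon_green S (moon_lines n S \<theta>) H = F.pt \<phi> 1 ` {..n}"
    and R: "moon_red S \<epsilon> (moon_lines n S \<theta>) l0 H = F.pt \<phi> (1 - \<epsilon>) ` {0<..<n}"
    using F.moon_green_eq[of \<phi>] F.moon_red_eq[of \<phi>] \<phi> by auto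
  show ?thesis
    by (rule that[of \<epsilon> S \<phi>]) (use F.moon_frame_axioms ch w in \<open>auto simp: G R\<close>)
qed

theorem theorem2:
  fixes n :: nat and L :: cake
  assumes "n \<ge> 2" and "is_moon n L"
  shows "(\<forall>cs. complete_play L cs \<and> follows_simple_greedy Bob L cs \<longrightarrow> red L \<subseteq> taken_by Bob cs)
    \<and> optimal_score L = num_red L \<and> num_red L = n - 1"
proof -
  obtain S \<phi> \<epsilon> where frame: "moon_frame n \<epsilon>"
    and ch: "cherries L = moon_frame.pt n S \<phi> 1 ` {..n} \<union> moon_frame.pt n S \<phi> (1 - \<epsilon>) ` {0<..<n}"
    and wg: "\<forall>k \<le> n. weight L (moon_frame.pt n S \<phi> 1 k) = 0"
    and wr: "\<forall>k \<in> {0<..<n}. weight L (moon_frame.pt n S \<phi> (1 - \<epsilon>) k) = 1"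
    using is_moon_normal_form[OF assms] by metis
  interpret moon_frame n S \<phi> \<epsilon> by (rule frame)
  let ?I = "{position a b J |a b J. a < b \<and> b \<le> n \<and> J \<subseteq> {a<..<b}}"
  have safe: "greedy_safe (weight L) ?I"
    using wg wr by (intro greedy_safe_positions) auto
  \<comment> \<open>Initially the ends are the two green cherries on the main line, and every
    interior direction still carries both of its cherries.\<close>
  have "insert 0 (insert n {0<..<n}) = {..n}" by auto
  then have "cherries L = position 0 n {0<..<n}"
    unfolding ch position_def by simp
  then have start: "cherries L \<in> ?I"
    using assms(1) by (intro CollectI exI[of _ 0] exI[of _ n] exI[of _ "{0<..<n}"]) auto
  have red: "red L = r ` {0<..<n}"
    using wg wr by (auto simp: red_def ch)
  have "inj_on r {0<..<n}"
    by (intro inj_onI) (auto simp: r_eq_iff)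
  then have "num_red L = n - 1"
    by (simp add: num_red_def red card_image)
  moreover have "optimal_score L = num_red L"
    using game_value_greedy_safe[OF safe start] by (simp add: optimal_score_def num_red_def red_def)
  ultimately show ?thesis
    using greedy_takes_red[OF safe start] by blast
qed

end
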